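(* Let $f:\mathbb{R}^n\to\mathbb{R}$ be smooth, strongly convex with parameters $L\ge\ell>0$ and let $x^*$ be its minimizer. Let $(x_k)_{k\ge 0}$ and $(y_k)_{k\ge 1}$ be generated by the Idealized Algorithm (IA) applied to $f$ from an arbitrary starting point $x_0\in\mathbb{R}^n$, and for $k\ge 1$ define $$\Psi_k=\|y_k-x^*\|^2+\frac{2(f(x_k)-f(x^* ))}{\ell}.$$ Then for each $k=1,2,\ldots$, $$\Psi_{k+1}\le\left(1-\sqrt{\frac{\ell}{L}}\right)\Psi_k .$$
   Context: A differentiable convex function $f:\mathbb{R}^n\to\mathbb{R}$ is smooth, strongly convex with parameters $L\ge\ell>0$ if for all $x,y\in\mathbb{R}^n$, $\ \ell\|x-y\|^2/2\le f(y)-f(x)-\nabla f(x)^T(y-x)\le L\|x-y\|^2/2$. Such $f$ has a unique minimizer $x^*$. $\|\cdot\|$ is the Euclidean norm. Idealized Algorithm (IA): $x_0$ is arbitrary; $\mathcal{M}_1:=x_0+\mathrm{span}\{\nabla f(x_0)\}$; for $k=1,2,\ldots$: (1) $x_k:=\mathrm{argmin}\{f(x):x\in\mathcal{M}_k\}$; (2) $y_k:=\mathrm{argmin}\{\|y-x^*\|:y\in\mathcal{M}_k\}$; (3) $\mathcal{M}_{k+1}:=x_k+\mathrm{span}\{y_k-x_k,\nabla f(x_k)\}$. *)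

theory Defs
  imports "HOL-Analysis.Analysis"
begin

text \<open>The value is meaningful only at points where \<open>f\<close> is differentiable.\<close>

definition grad :: "('a::euclidean_space \<Rightarrow> real) \<Rightarrow> 'a \<Rightarrow> 'a" where
  "grad f x = (THE g. GDERIV f x :> g)"

definition smooth_strongly_convex ::
  "real \<Rightarrow> real \<Rightarrow> ('a::euclidean_space \<Rightarrow> real) \<Rightarrow> bool" where
  "smooth_strongly_convex L l f \<longleftrightarrow>
     0 < l \<and> l \<le> L \<and> f differentiable_on UNIV \<and> convex_on UNIV f \<and>
     (\<forall>x y. l * (norm (x - y))\<^sup>2 / 2 \<le> f y - f x - grad f x \<bullet> (y - x) \<and>
            f y - f x - grad f x \<bullet> (y - x) \<le> L * (norm (x - y))\<^sup>2 / 2)"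

text \<open>
  \<open>ideal_alg f xs x y M\<close>: the sequences of points \<open>x\<close>, \<open>y\<close> and of affine sets \<open>M\<close> form a run of
  the idealized algorithm, where \<open>xs\<close> is the minimizer of \<open>f\<close>.  The starting point \<open>x 0\<close> is
  arbitrary; \<open>y 0\<close> and \<open>M 0\<close> are not used.
\<close>

definition ideal_alg ::
  "('a::euclidean_space \<Rightarrow> real) \<Rightarrow> 'a \<Rightarrow> (nat \<Rightarrow> 'a) \<Rightarrow> (nat \<Rightarrow> 'a) \<Rightarrow> (nat \<Rightarrow> 'a set) \<Rightarrow> bool" where
  "ideal_alg f xs x y M \<longleftrightarrow>
     M 1 = (+) (x 0) ` span {grad f (x 0)} \<and>
     (\<forall>k\<ge>1. is_arg_min f (\<lambda>z. z \<in> M k) (x k) \<and>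
            is_arg_min (\<lambda>z. norm (z - xs)) (\<lambda>z. z \<in> M k) (y k) \<and>
            M (k + 1) = (+) (x k) ` span {y k - x k, grad f (x k)})"

definition Psi ::
  "real \<Rightarrow> ('a::euclidean_space \<Rightarrow> real) \<Rightarrow> 'a \<Rightarrow> (nat \<Rightarrow> 'a) \<Rightarrow> (nat \<Rightarrow> 'a) \<Rightarrow> nat \<Rightarrow> real" where
  "Psi l f xs x y k = (norm (y k - xs))\<^sup>2 + 2 * (f (x k) - f xs) / l"

end

theory Submission
  imports Defs
begin

text \<open>
  Exact minimization over \<open>M k\<close> makes the gradient \<open>g\<close> at \<open>x k\<close> orthogonal to \<open>y k - x k\<close>.  With
  \<open>a = sqrt (l / L)\<close>, compare \<open>x (k + 1)\<close> with the gradient step \<open>x k - g / L\<close>, and \<open>y (k + 1)\<close> with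
  \<open>(1 - a) y k + a (x k - g / l)\<close>; both candidates lie in \<open>M (k + 1)\<close>.  The decrease
  \<open>\<parallel>g\<parallel>\<^sup>2 / (l L)\<close> of the function-value part of the potential is exactly the possible increase of
  the distance part, since \<open>a\<^sup>2 / l\<^sup>2 = 1 / (l L)\<close>.
\<close>

text \<open>A quadratic in \<open>t\<close> that vanishes at 0 and is never negative has no linear
  term. For \<open>d \<noteq> 0\<close> this is seen at its minimizer
  \<open>t = - (g \<bullet> d / N)\<close>, where its value is
  \<open>- ((g \<bullet> d)\<^sup>2 / (2 * N))\<close>.\<close>

lemma orthogonal_of_quadratic_bound:
  fixes g d :: "'a::real_inner"
  assumes "L > 0" and bound: "\<And>t. 0 \<le> t * (g \<bullet> d) + L * t\<^sup>2 * (norm d)\<^sup>2 / 2"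
  shows "g \<bullet> d = 0"
proof (cases "d = 0")
  case False
  define N where "N = L * (norm d)\<^sup>2"
  have N: "N > 0"
    using False \<open>L > 0\<close> by (simp add: N_def)
  have "0 \<le> - (g \<bullet> d / N) * (g \<bullet> d) + N * (- (g \<bullet> d / N))\<^sup>2 / 2"
    using bound[of "- (g \<bullet> d / N)"] by (simp add: N_def ac_simps)
  also have "\<dots> = - ((g \<bullet> d)\<^sup>2 / (2 * N))"
    using N by (simp add: field_simps power2_eq_square)
  finally have "(g \<bullet> d)\<^sup>2 \<le> 0"
    using N by (simp add: divide_le_0_iff)
  then show ?thesis by simp
qed simp

text \<open>\<open>D\<close> stands for \<open>f x - f xs\<close>, so \<open>strong\<close> is the
  strong convexity bound at \<open>x\<close> tested at \<open>xs\<close>. Plain convexity of the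
  squared norm would leave \<open>a\<close> in front of \<open>(norm g)\<^sup>2 / l\<^sup>2\<close>;
  orthogonality keeps the two combined points far enough apart to lower it to
  \<open>a\<^sup>2\<close>.\<close>

lemma convex_combination_dist_le:
  fixes x y xs g :: "'a::real_inner"
  assumes "l > 0" "0 \<le> a" "a \<le> 1" and orth: "g \<bullet> (y - x) = 0"
    and strong: "l * (norm (x - xs))\<^sup>2 / 2 \<le> - D - g \<bullet> (xs - x)"
  shows "(norm ((1 - a) *\<^sub>R y + a *\<^sub>R (x - g /\<^sub>R l) - xs))\<^sup>2
    \<le> (1 - a) * (norm (y - xs))\<^sup>2 + a\<^sup>2 * (norm g)\<^sup>2 / l\<^sup>2 - 2 * a * D / l"
proof -
  define v w where "v = y - xs" and "w = x - g /\<^sub>R l - xs"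
  define G where "G = (norm g)\<^sup>2 / l\<^sup>2"
  have "w = (x - xs) - g /\<^sub>R l"
    by (simp add: w_def)
  then have "(norm w)\<^sup>2 = (norm ((x - xs) - g /\<^sub>R l))\<^sup>2"
    by simp
  also have "\<dots> = (norm (x - xs))\<^sup>2 + 2 * (g \<bullet> (xs - x)) / l + G"
    unfolding G_def power2_norm_eq_inner
    by (simp add: inner_diff_left inner_diff_right inner_commute divide_inverse power2_eq_square
        algebra_simps)
  finally have "(norm w)\<^sup>2 = (norm (x - xs))\<^sup>2 + 2 * (g \<bullet> (xs - x)) / l + G" .
  \<comment> \<open>This is \<open>strong\<close> scaled by \<open>2 / l\<close>. It places
    \<open>xs\<close> in a ball around \<open>x - g /\<^sub>R l\<close> of squared radius
    \<open>G - 2 * D / l\<close>.\<close>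
  moreover have "(norm (x - xs))\<^sup>2 + 2 * (g \<bullet> (xs - x)) / l \<le> - 2 * D / l"
  proof (rule mult_left_le_imp_le[OF _ \<open>l > 0\<close>])
    show "l * ((norm (x - xs))\<^sup>2 + 2 * (g \<bullet> (xs - x)) / l) \<le> l * (- 2 * D / l)"
      using strong \<open>l > 0\<close> by (simp add: distrib_left)
  qed
  ultimately have w: "(norm w)\<^sup>2 \<le> G - 2 * D / l" by simp
  have "v - w = (y - x) + g /\<^sub>R l"
    by (simp add: v_def w_def)
  then have "(norm (v - w))\<^sup>2 = (norm ((y - x) + g /\<^sub>R l))\<^sup>2"
    by simp
  also have "\<dots> = (norm (y - x))\<^sup>2 + (norm (g /\<^sub>R l))\<^sup>2"
    using orth by (intro norm_add_Pythagorean) (simp add: orthogonal_def inner_commute)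
  also have "(norm (g /\<^sub>R l))\<^sup>2 = G"
    by (simp add: G_def power_mult_distrib divide_inverse power_inverse)
  finally have vw: "(norm (v - w))\<^sup>2 \<ge> G" by simp
  have "(1 - a) *\<^sub>R y + a *\<^sub>R (x - g /\<^sub>R l) - xs = (1 - a) *\<^sub>R v + a *\<^sub>R w"
    by (simp add: v_def w_def algebra_simps)
  \<comment> \<open>The exact identity is used because its last term, bounded through
    \<open>vw\<close>, supplies the gain \<open>a * (1 - a) * G\<close>.\<close>
  moreover have "(norm ((1 - a) *\<^sub>R v + a *\<^sub>R w))\<^sup>2
      = (1 - a) * (norm v)\<^sup>2 + a * (norm w)\<^sup>2 - a * (1 - a) * (norm (v - w))\<^sup>2"
    unfolding power2_norm_eq_inner
    by (simp add: inner_add_left inner_add_right inner_diff_left inner_diff_right inner_commute)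
      (simp add: algebra_simps)
  moreover have "a * (norm w)\<^sup>2 \<le> a * (G - 2 * D / l)"
    using w assms by (intro mult_left_mono) auto
  moreover have "a * (1 - a) * G \<le> a * (1 - a) * (norm (v - w))\<^sup>2"
    using vw assms by (intro mult_left_mono) auto
  moreover have "a * (G - 2 * D / l) - a * (1 - a) * G = a\<^sup>2 * G - 2 * a * D / l"
    by (simp add: algebra_simps power2_eq_square)
  ultimately show ?thesis by (simp add: G_def v_def)
qed

text \<open>Gives \<open>M 1\<close> and the later sets a common affine form, so that the line
  through two points of \<open>M k\<close> stays in \<open>M k\<close>.\<close>

lemma ideal_alg_subspace:
  assumes "ideal_alg f xs x y M" "k \<ge> 1"
  obtains c S where "M k = (+) c ` span S"
proof (cases "k = 1")
  case True
  then show ?thesis using assms(1) that by (simp add: ideal_alg_def)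
next
  case False
  then obtain j where j: "k = j + 1" "j \<ge> 1"
    using assms(2) that[of "k - 1"] by simp
  then have "M k = (+) (x j) ` span {y j - x j, grad f (x j)}"
    using assms(1) by (simp add: ideal_alg_def)
  then show ?thesis by (rule that)
qed

lemma line_in_translated_span:
  assumes "x \<in> (+) c ` span S" "y \<in> (+) c ` span S"
  shows "x + t *\<^sub>R (y - x) \<in> (+) c ` span S"
proof -
  obtain u v where uv: "u \<in> span S" "v \<in> span S" "x = c + u" "y = c + v"
    using assms by auto
  then have "u + t *\<^sub>R (v - u) \<in> span S"
    by (intro span_add span_scale span_diff)
  moreover have "x + t *\<^sub>R (y - x) = c + (u + t *\<^sub>R (v - u))"
    using uv by simp
  ultimately show ?thesis by blast
qed

lemma smooth_upper_bound:
  assumes "smooth_strongly_convex L l f"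
  shows "f (x + d) - f x - grad f x \<bullet> d \<le> L * (norm d)\<^sup>2 / 2"
proof -
  have "f (x + d) - f x - grad f x \<bullet> (x + d - x) \<le> L * (norm (x - (x + d)))\<^sup>2 / 2"
    using assms unfolding smooth_strongly_convex_def by blast
  then show ?thesis by simp
qed

text \<open>The line through \<open>x k\<close> and \<open>y k\<close> lies in \<open>M k\<close>,
  so \<open>x k\<close> minimizes \<open>f\<close> along it. The upper quadratic bound turns this
  into a nonnegative quadratic in \<open>t\<close>.\<close>

lemma ideal_alg_grad_orthogonal:
  assumes f: "smooth_strongly_convex L l f" and alg: "ideal_alg f xs x y M" and k: "k \<ge> 1"
  shows "grad f (x k) \<bullet> (y k - x k) = 0"
proof (rule orthogonal_of_quadratic_bound)
  show "L > 0" using f by (simp add: smooth_strongly_convex_def)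
  fix t
  obtain c S where "M k = (+) c ` span S"
    using ideal_alg_subspace[OF alg k] .
  moreover have "x k \<in> M k" "y k \<in> M k"
    and min: "\<And>z. z \<in> M k \<Longrightarrow> f (x k) \<le> f z"
    using alg k by (auto simp: ideal_alg_def is_arg_min_linorder)
  ultimately have "f (x k) \<le> f (x k + t *\<^sub>R (y k - x k))"
    using line_in_translated_span[of "x k" c S "y k" t] by simp
  moreover have "f (x k + t *\<^sub>R (y k - x k)) - f (x k) - grad f (x k) \<bullet> (t *\<^sub>R (y k - x k))
      \<le> L * (norm (t *\<^sub>R (y k - x k)))\<^sup>2 / 2"
    by (rule smooth_upper_bound[OF f])
  ultimately show "0 \<le> t * (grad f (x k) \<bullet> (y k - x k)) + L * t\<^sup>2 * (norm (y k - x k))\<^sup>2 / 2"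
    by (simp add: power_mult_distrib mult.assoc)
qed

text \<open>The step length \<open>1 / L\<close> minimizes the upper quadratic bound along the
  negative gradient.\<close>

lemma gradient_step_decrease:
  assumes "smooth_strongly_convex L l f"
  shows "f (x - grad f x /\<^sub>R L) \<le> f x - (norm (grad f x))\<^sup>2 / (2 * L)"
proof -
  define d N where "d = - (grad f x /\<^sub>R L)" and "N = (norm (grad f x))\<^sup>2 / L"
  have "L > 0" using assms by (simp add: smooth_strongly_convex_def)
  have "norm d = norm (grad f x) / L"
    using \<open>L > 0\<close> by (simp add: d_def divide_inverse_commute)
  then have "L * (norm d)\<^sup>2 = N"
    unfolding N_def by (simp only: power_divide) (simp add: power2_eq_square)
  moreover have "grad f x \<bullet> d = - N"
    by (simp add: d_def N_def power2_norm_eq_inner divide_inverse mult.commute)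
  ultimately have "f (x + d) \<le> f x - N / 2"
    using smooth_upper_bound[OF assms, of x d] by simp
  then show ?thesis by (simp add: d_def N_def mult.commute)
qed

theorem theorem1:
  fixes f :: "real ^ 'n \<Rightarrow> real" and L l :: real
    and xs :: "real ^ 'n" and x y :: "nat \<Rightarrow> real ^ 'n" and M :: "nat \<Rightarrow> (real ^ 'n) set"
  assumes "smooth_strongly_convex L l f"
    and "is_arg_min f (\<lambda>_. True) xs"
    and "ideal_alg f xs x y M"
  shows "\<forall>k\<ge>1. Psi l f xs x y (k + 1) \<le> (1 - sqrt (l / L)) * Psi l f xs x y k"
proof (intro allI impI)
  fix k :: nat
  assume k: "k \<ge> 1"
  define g a D where "g = grad f (x k)" and "a = sqrt (l / L)" and "D = f (x k) - f xs"
  have l: "0 < l" "l \<le> L" using assms(1) by (auto simp: smooth_strongly_convex_def)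
  then have a: "0 \<le> a" "a \<le> 1" "a\<^sup>2 = l / L" by (auto simp: a_def)
  have M: "M (k + 1) = (+) (x k) ` span {y k - x k, g}"
    using assms(3) k by (simp add: ideal_alg_def g_def)
  have xmin: "z \<in> M (k + 1) \<Longrightarrow> f (x (k + 1)) \<le> f z"
    and ymin: "z \<in> M (k + 1) \<Longrightarrow> norm (y (k + 1) - xs) \<le> norm (z - xs)" for z
    using assms(3) unfolding ideal_alg_def is_arg_min_linorder by simp_all
  have mem: "x k + (s *\<^sub>R (y k - x k) + t *\<^sub>R g) \<in> M (k + 1)" for s t
    unfolding M by (intro imageI span_add span_scale span_base) auto

  have "x k - g /\<^sub>R L \<in> M (k + 1)"
    using mem[of 0 "- inverse L"] by simp
  then have "f (x (k + 1)) \<le> f (x k) - (norm g)\<^sup>2 / (2 * L)"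
    using xmin[of "x k - g /\<^sub>R L"] gradient_step_decrease[OF assms(1), of "x k"]
    by (simp add: g_def)
  then have "2 * (f (x (k + 1)) - f xs) / l \<le> 2 * (D - (norm g)\<^sup>2 / (2 * L)) / l"
    using l by (intro divide_right_mono) (auto simp: D_def)
  also have "\<dots> = 2 * D / l - a\<^sup>2 * (norm g)\<^sup>2 / l\<^sup>2"
    using l unfolding a(3) by (simp add: field_simps power2_eq_square)
  finally have fpart: "2 * (f (x (k + 1)) - f xs) / l \<le> 2 * D / l - a\<^sup>2 * (norm g)\<^sup>2 / l\<^sup>2" .

  \<comment> \<open>Expanded around \<open>x k\<close>, the offset is \<open>1 - a\<close> times
    \<open>y k - x k\<close> minus \<open>a / l\<close> times \<open>g\<close>.\<close>
  have "(1 - a) *\<^sub>R y k + a *\<^sub>R (x k - g /\<^sub>R l) \<in> M (k + 1)"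
    using mem[of "1 - a" "- (a / l)"] by (simp add: algebra_simps divide_inverse)
  then have "(norm (y (k + 1) - xs))\<^sup>2 \<le> (norm ((1 - a) *\<^sub>R y k + a *\<^sub>R (x k - g /\<^sub>R l) - xs))\<^sup>2"
    by (intro power_mono ymin) auto
  also have "\<dots> \<le> (1 - a) * (norm (y k - xs))\<^sup>2 + a\<^sup>2 * (norm g)\<^sup>2 / l\<^sup>2 - 2 * a * D / l"
  proof (rule convex_combination_dist_le)
    show "g \<bullet> (y k - x k) = 0"
      using ideal_alg_grad_orthogonal[OF assms(1,3) k] by (simp add: g_def)
    have "l * (norm (x k - xs))\<^sup>2 / 2 \<le> f xs - f (x k) - g \<bullet> (xs - x k)"
      using assms(1) by (simp add: smooth_strongly_convex_def g_def)
    then show "l * (norm (x k - xs))\<^sup>2 / 2 \<le> - D - g \<bullet> (xs - x k)"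
      by (simp add: D_def)
  qed (use l a in auto)
  finally have "Psi l f xs x y (k + 1)
      \<le> (1 - a) * (norm (y k - xs))\<^sup>2 - 2 * a * D / l + 2 * D / l"
    using fpart by (simp add: Psi_def)
  \<comment> \<open>The two terms in \<open>D\<close> add up to
    \<open>(1 - a) * (2 * D / l)\<close>, so the value part contracts by the same factor as the
    distance part.\<close>
  also have "\<dots> = (1 - a) * Psi l f xs x y k"
    using l by (simp add: Psi_def D_def field_simps)
  finally show "Psi l f xs x y (k + 1) \<le> (1 - sqrt (l / L)) * Psi l f xs x y k"
    by (simp add: a_def)
qed

end
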